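(* If $(R,\Longrightarrow)$ is a Noetherian reduction ring, then the polynomial ring $(R[X],\longrightarrow)$ in one variable, with the reduction relation $\longrightarrow$ described in the context, is a Noetherian reduction ring.
   Context: $R$ is an associative, not necessarily commutative ring with unit; "ideal" means two-sided ideal, $\mathrm{ideal}_R(B)$ is the ideal generated by $B$, and Noetherian means every ideal is finitely generated. A reduction relation on a ring $R$ is a family of binary relations $\Longrightarrow_\beta$ on $R$, $\beta\in R$; for $B\subseteq R$ one has a relation $\Longrightarrow_B$, with reflexive symmetric transitive closure $\stackrel{*}{\Longleftrightarrow}_B$. Axioms: (A1) $\Longrightarrow_B=\bigcup_{\beta\in B}\Longrightarrow_\beta$, and $\Longrightarrow_B$ is terminating for every finite $B\subseteq R$. (A2) $\alpha\Longrightarrow_\beta\gamma$ implies $\alpha-\gamma\in\mathrm{ideal}_R(\{\beta\})$. (A3) $\alpha\Longrightarrow_\alpha 0$ for all $\alpha\in R\setminus\{0\}$. A subset $B\subseteq R$ is a Gröbner basis of $\mathfrak i=\mathrm{ideal}_R(B)$ if $\stackrel{*}{\Longleftrightarrow}_B$ equals the congruence modulo $\mathfrak i$ and $\Longrightarrow_B$ is complete (terminating and confluent). $(R,\Longrightarrow)$ satisfying (A1)–(A3) is a reduction ring if every finitely generated ideal has a finite Gröbner basis. A Noetherian reduction ring is a reduction ring whose underlying ring is Noetherian. Polynomial ring: in $R[X]$ coefficients commute with $X$, i.e. $\alpha X=X\alpha$ for $\alpha\in R$. Terms are $X^i$, ordered by exponent; $\operatorname{HT}(f)$ and $\operatorname{HC}(f)$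 denote the leading term and leading coefficient of $f\ne 0$. For non-zero $p,f\in R[X]$, $f$ reduces $p$ to $q$ at a monomial $\alpha X^i$ of $p$ in one step, $p\longrightarrow_f q$, if (a) $\operatorname{HT}(f)X^j=X^i$ for some $j\ge 0$; (b) $\alpha\Longrightarrow_{\operatorname{HC}(f)}\beta$ with $\alpha=\beta+\sum_{l=1}^n\gamma_l\operatorname{HC}(f)\delta_l$ for some $\beta,\gamma_l,\delta_l\in R$; (c) $q=p-\sum_{l=1}^n(\gamma_l f\delta_l)X^j$. $\longrightarrow_F=\bigcup_{f\in F}\longrightarrow_f$. *)

theory Defs
  imports
    "HOL-Algebra.UnivPoly"
    "HOL-Algebra.Ring_Divisibility"
    "HOL-Library.Confluence"
begin

text \<open>A family of one-step relations is a function \<open>red\<close>, where \<open>red b x y\<close> means that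
  \<open>x\<close> reduces to \<open>y\<close> by \<open>b\<close>.\<close>

definition red_by_set :: "('a \<Rightarrow> 'a \<Rightarrow> 'a \<Rightarrow> bool) \<Rightarrow> 'a set \<Rightarrow> 'a \<Rightarrow> 'a \<Rightarrow> bool"
  where "red_by_set red B x y \<longleftrightarrow> (\<exists>b\<in>B. red b x y)"

definition terminating :: "('a \<Rightarrow> 'a \<Rightarrow> bool) \<Rightarrow> bool"
  where "terminating r \<longleftrightarrow> \<not> (\<exists>s :: nat \<Rightarrow> 'a. \<forall>i. r (s i) (s (Suc i)))"

definition groebner_basis ::
    "('a, 'm) ring_scheme \<Rightarrow> ('a \<Rightarrow> 'a \<Rightarrow> 'a \<Rightarrow> bool) \<Rightarrow> 'a set \<Rightarrow> 'a set \<Rightarrow> bool"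
  where "groebner_basis R red I B \<longleftrightarrow>
    B \<subseteq> carrier R \<and> I = Idl\<^bsub>R\<^esub> B \<and>
    (\<forall>x\<in>carrier R. \<forall>y\<in>carrier R. equivclp (red_by_set red B) x y \<longleftrightarrow> x \<ominus>\<^bsub>R\<^esub> y \<in> I) \<and>
    terminating (red_by_set red B) \<and> confluentp (red_by_set red B)"

locale reduction_relation = ring R for R (structure) +
  fixes red :: "'a \<Rightarrow> 'a \<Rightarrow> 'a \<Rightarrow> bool"
  assumes red_closed:
      "\<lbrakk>b \<in> carrier R; red b x y\<rbrakk> \<Longrightarrow> x \<in> carrier R \<and> y \<in> carrier R"
    and red_terminating:
      "\<lbrakk>B \<subseteq> carrier R; finite B\<rbrakk> \<Longrightarrow> terminating (red_by_set red B)"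
    and red_ideal:
      "\<lbrakk>b \<in> carrier R; red b x y\<rbrakk> \<Longrightarrow> x \<ominus> y \<in> Idl {b}"
    and red_self:
      "x \<in> carrier R - {\<zero>} \<Longrightarrow> red x x \<zero>"

locale reduction_ring = reduction_relation +
  assumes finite_groebner_basis:
    "\<lbrakk>A \<subseteq> carrier R; finite A\<rbrakk> \<Longrightarrow> \<exists>B. finite B \<and> groebner_basis R red (Idl A) B"

locale noetherian_reduction_ring = reduction_ring + noetherian_ring

text \<open>In \<^term>\<open>UP R\<close> the coefficients commute with the variable even if \<open>R\<close> is not commutative.
  The term \<open>X\<^sup>i\<close> is represented by its exponent \<open>i\<close>, so the leading term of a nonzero \<open>f\<close> is
  \<^term>\<open>deg R f\<close> and a product of terms is a sum of exponents.\<close>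

definition head_coeff :: "('a, 'm) ring_scheme \<Rightarrow> (nat \<Rightarrow> 'a) \<Rightarrow> 'a"
  where "head_coeff R f = coeff (UP R) f (deg R f)"

text \<open>\<open>poly_red_at R red f i p q\<close>: \<open>f\<close> reduces \<open>p\<close> to \<open>q\<close> at the monomial of \<open>p\<close> with
  exponent \<open>i\<close>. Ring elements act on \<open>f\<close> from either side through the constant polynomials.\<close>

definition poly_red_at ::
    "('a, 'm) ring_scheme \<Rightarrow> ('a \<Rightarrow> 'a \<Rightarrow> 'a \<Rightarrow> bool) \<Rightarrow>
     (nat \<Rightarrow> 'a) \<Rightarrow> nat \<Rightarrow> (nat \<Rightarrow> 'a) \<Rightarrow> (nat \<Rightarrow> 'a) \<Rightarrow> bool"
  where "poly_red_at R red f i p q \<longleftrightarrow>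
    f \<in> carrier (UP R) - {\<zero>\<^bsub>UP R\<^esub>} \<and> p \<in> carrier (UP R) - {\<zero>\<^bsub>UP R\<^esub>} \<and>
    coeff (UP R) p i \<noteq> \<zero>\<^bsub>R\<^esub> \<and>
    (\<exists>j b (n :: nat) c d.
       deg R f + j = i \<and>
       b \<in> carrier R \<and> c \<in> {1..n} \<rightarrow> carrier R \<and> d \<in> {1..n} \<rightarrow> carrier R \<and>
       red (head_coeff R f) (coeff (UP R) p i) b \<and>
       coeff (UP R) p i =
         b \<oplus>\<^bsub>R\<^esub> (\<Oplus>\<^bsub>R\<^esub>l\<in>{1..n}. c l \<otimes>\<^bsub>R\<^esub> head_coeff R f \<otimes>\<^bsub>R\<^esub> d l) \<and>
       q = p \<ominus>\<^bsub>UP R\<^esub>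
         (\<Oplus>\<^bsub>UP R\<^esub>l\<in>{1..n}. monom (UP R) (c l) 0 \<otimes>\<^bsub>UP R\<^esub> f \<otimes>\<^bsub>UP R\<^esub> monom (UP R) (d l) 0)
           \<otimes>\<^bsub>UP R\<^esub> monom (UP R) \<one>\<^bsub>R\<^esub> j)"

definition poly_red ::
    "('a, 'm) ring_scheme \<Rightarrow> ('a \<Rightarrow> 'a \<Rightarrow> 'a \<Rightarrow> bool) \<Rightarrow>
     (nat \<Rightarrow> 'a) \<Rightarrow> (nat \<Rightarrow> 'a) \<Rightarrow> (nat \<Rightarrow> 'a) \<Rightarrow> bool"
  where "poly_red R red f p q \<longleftrightarrow> (\<exists>i. poly_red_at R red f i p q)"

end

theory Submission
  imports Defs
begin

text \<open>For an ideal \<open>I\<close> of \<open>R[X]\<close>, the coefficients at \<open>X\<^sup>n\<close> of the elements of \<open>I\<close> of degree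
  at most \<open>n\<close> form an ideal \<open>L\<^sub>n\<close> of \<open>R\<close>. The ascending chain of the \<open>L\<^sub>n\<close> is constant from some
  \<open>N\<close> on. Lift finite Groebner bases of \<open>L\<^sub>0, \<dots>, L\<^sub>N\<close> to elements of \<open>I\<close> with these leading
  coefficients. If \<open>p \<noteq> q\<close> are congruent modulo \<open>I\<close> and differ first, from the top, at \<open>X\<^sup>i\<close>, then
  their coefficients there are distinct and congruent modulo \<open>L\<^sub>i\<close>, so one of them is reducible by
  the Groebner basis of \<open>L\<^sub>i\<close>, and hence \<open>p\<close> or \<open>q\<close> is reducible. So irreducible representatives
  of residue classes are unique, which makes the lifts a Groebner basis of \<open>I\<close> and, since \<open>I\<close>
  was arbitrary, also shows that \<open>R[X]\<close> is Noetherian. Polynomial reduction only acts on nonzero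
  coefficients; this loses nothing because \<open>0\<close> is irreducible in \<open>R\<close>: otherwise
  \<open>0 \<Longrightarrow> y \<Longrightarrow> 0\<close> by (A3), against termination.\<close>

section \<open>Terminating relations and their sequences\<close>

lemma terminating_iff_wfp: "terminating r \<longleftrightarrow> wfp r\<inverse>\<inverse>"
  unfolding terminating_def wfp_def wf_iff_no_infinite_down_chain by simp

lemma terminating_no_2_cycle:
  assumes "terminating r" "r x y"
  shows "\<not> r y x"
proof
  assume "r y x"
  with assms(2) have "\<forall>i. r (if even i then x else y) (if even (Suc i) then x else y)" by simp
  then have "\<exists>s. \<forall>i. r (s i) (s (Suc i))" by (rule exI[where P = "\<lambda>s. \<forall>i. r (s i) (s (Suc i))"])
  with assms(1) show False unfolding terminating_def by contradiction
qed

lemma terminating_no_loop: "terminating r \<Longrightarrow> \<not> r x x"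
  using terminating_no_2_cycle by metis

lemma terminating_normal_form:
  assumes "terminating r"
  shows "\<exists>y. r\<^sup>*\<^sup>* x y \<and> (\<forall>z. \<not> r y z)"
proof -
  have "wfp r\<inverse>\<inverse>" using assms by (simp add: terminating_iff_wfp)
  then show ?thesis
  proof (induction x rule: wfp_induct_rule)
    case (less x)
    show ?case
    proof (cases "\<exists>z. r x z")
      case True
      then obtain z where "r x z" by blast
      then show ?thesis using less[of z] by (meson conversepI converse_rtranclp_into_rtranclp)
    qed auto
  qed
qed

text \<open>By well-foundedness some value \<open>s M\<close> with \<open>M\<close> at least
  \<open>m\<close> has no later value strictly below it; as \<open>s M\<close> reaches every later
  \<open>s n\<close>, all of these equal it. It serves for the coefficients of a reduction sequence
  at a fixed exponent.\<close>

lemma terminating_eventually_constant: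
  assumes "terminating r" and step: "\<And>n. n \<ge> m \<Longrightarrow> s (Suc n) = s n \<or> r (s n) (s (Suc n))"
  shows "\<exists>M\<ge>m. \<forall>n\<ge>M. s n = s M"
proof -
  have "wfp (r\<inverse>\<inverse>)\<^sup>+\<^sup>+" using assms(1) by (simp add: terminating_iff_wfp wfp_tranclp)
  moreover have "s m \<in> s ` {m..}" by simp
  ultimately obtain z where "z \<in> s ` {m..}" and min: "\<And>y. (r\<inverse>\<inverse>)\<^sup>+\<^sup>+ y z \<Longrightarrow> y \<notin> s ` {m..}"
    unfolding wfp_eq_minimal by meson
  then obtain M where M: "M \<ge> m" "z = s M" by auto
  have "s n = s M" if "n \<ge> M" for n
  proof -
    have "r\<^sup>*\<^sup>* (s M) (s n)" using that
    proof (induction n rule: dec_induct)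
      case (step n)
      then show ?case using assms(2)[of n] M by (metis le_trans rtranclp.rtrancl_into_rtrancl)
    qed simp
    moreover have "\<not> r\<^sup>+\<^sup>+ (s M) (s n)"
      using min[of "s n"] M that by (auto simp: tranclp_converse)
    ultimately show ?thesis by (metis rtranclpD)
  qed
  with M show ?thesis by blast
qed

section \<open>Two-sided principal ideals and congruences\<close>

text \<open>The set \<open>S\<close> of these sums is an ideal containing \<open>a\<close>, so it
  contains \<open>Idl {a}\<close>. Since \<open>R\<close> need not be commutative, a single product
  \<open>u \<otimes> a \<otimes> v\<close> is in general not enough. Combined with (A2) this yields
  the coefficients that condition (b) asks for.\<close>

lemma (in ring) genideal_singleton_finsum:
  assumes a: "a \<in> carrier R" and x: "x \<in> Idl {a}"
  shows "\<exists>n c d. c \<in> {1..n::nat} \<rightarrow> carrier R \<and> d \<in> {1..n} \<rightarrow> carrier R \<and>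
           x = (\<Oplus>l\<in>{1..n}. c l \<otimes> a \<otimes> d l)"
proof -
  define S where "S = {x. \<exists>n c d. c \<in> {1..n::nat} \<rightarrow> carrier R \<and> d \<in> {1..n} \<rightarrow> carrier R \<and>
           x = (\<Oplus>l\<in>{1..n}. c l \<otimes> a \<otimes> d l)}"
  have S_carrier: "S \<subseteq> carrier R"
    unfolding S_def using a by (auto intro!: finsum_closed simp: Pi_def)
  have zero: "\<zero> \<in> S" unfolding S_def by (auto intro!: exI[of _ "0::nat"])
  have S_step: "x \<oplus> u \<otimes> a \<otimes> v \<in> S" if x: "x \<in> S" and u: "u \<in> carrier R" and v: "v \<in> carrier R" for x u v
  proof -
    obtain n c d where c: "c \<in> {1..n::nat} \<rightarrow> carrier R" and d: "d \<in> {1..n} \<rightarrow> carrier R"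
      and xeq: "x = (\<Oplus>l\<in>{1..n}. c l \<otimes> a \<otimes> d l)" using x unfolding S_def by blast
    let ?c = "c(Suc n := u)" and ?d = "d(Suc n := v)"
    have "(\<Oplus>l\<in>{1..n}. ?c l \<otimes> a \<otimes> ?d l) = x" unfolding xeq
      by (rule finsum_cong') (use a c d in \<open>auto simp: Pi_def\<close>)
    moreover have "{1..Suc n} = insert (Suc n) {1..n}" by auto
    ultimately have "(\<Oplus>l\<in>{1..Suc n}. ?c l \<otimes> a \<otimes> ?d l) = u \<otimes> a \<otimes> v \<oplus> x"
      using a c d u v by (simp add: Pi_def)
    also have "\<dots> = x \<oplus> u \<otimes> a \<otimes> v" using a_comm a u v x S_carrier by auto
    finally have "x \<oplus> u \<otimes> a \<otimes> v = (\<Oplus>l\<in>{1..Suc n}. ?c l \<otimes> a \<otimes> ?d l)" ..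
    moreover have "?c \<in> {1..Suc n} \<rightarrow> carrier R" "?d \<in> {1..Suc n} \<rightarrow> carrier R"
      using c d u v by (auto simp: Pi_def)
    ultimately show ?thesis unfolding S_def by blast
  qed
  \<comment> \<open>Induction on the number of summands becomes an induction rule for
    \<open>S\<close>. With \<open>S_step\<close>, each closure property then needs only the case of
    one further summand, and no sums have to be concatenated.\<close>
  have S_induct [consumes 1, case_names zero step]: "P x" if "x \<in> S" and P0: "P \<zero>"
    and Ps: "\<And>x u v. \<lbrakk>x \<in> S; P x; u \<in> carrier R; v \<in> carrier R\<rbrakk> \<Longrightarrow> P (x \<oplus> u \<otimes> a \<otimes> v)" for P x
  proof -
    have "P (\<Oplus>l\<in>{1..n}. c l \<otimes> a \<otimes> d l)"
      if "c \<in> {1..n::nat} \<rightarrow> carrier R" "d \<in> {1..n} \<rightarrow> carrier R" for n c d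
      using that
    proof (induction n)
      case (Suc n)
      let ?x = "\<Oplus>l\<in>{1..n}. c l \<otimes> a \<otimes> d l"
      have cd: "c \<in> {1..n} \<rightarrow> carrier R" "d \<in> {1..n} \<rightarrow> carrier R"
        "c (Suc n) \<in> carrier R" "d (Suc n) \<in> carrier R"
        using Suc.prems by (auto simp: Pi_def)
      then have x: "?x \<in> S" unfolding S_def by blast
      have "{1..Suc n} = insert (Suc n) {1..n}" by auto
      then have "(\<Oplus>l\<in>{1..Suc n}. c l \<otimes> a \<otimes> d l) = c (Suc n) \<otimes> a \<otimes> d (Suc n) \<oplus> ?x"
        using a cd by (simp add: Pi_def)
      also have "\<dots> = ?x \<oplus> c (Suc n) \<otimes> a \<otimes> d (Suc n)"
        using a_comm a cd x S_carrier by auto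
      finally show ?case using Ps[OF x Suc.IH[OF cd(1,2)] cd(3,4)] by simp
    qed (simp add: P0)
    with \<open>x \<in> S\<close> show ?thesis unfolding S_def by blast
  qed
  have add: "x \<oplus> y \<in> S" if x: "x \<in> S" and y: "y \<in> S" for x y
    using y
  proof (induction rule: S_induct)
    case (step y u v)
    have "x \<in> carrier R" "y \<in> carrier R" using x step(1) S_carrier by auto
    then have "x \<oplus> (y \<oplus> u \<otimes> a \<otimes> v) = (x \<oplus> y) \<oplus> u \<otimes> a \<otimes> v"
      using a step by (simp add: a_assoc)
    with S_step[of "x \<oplus> y" u v] step show ?case by simp
  qed (use x S_carrier in auto)
  have lmult: "r \<otimes> x \<in> S" if r: "r \<in> carrier R" and x: "x \<in> S" for r x
    using x
  proof (induction rule: S_induct)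
    case (step y u v)
    have y: "y \<in> carrier R" using step S_carrier by blast
    have "r \<otimes> (y \<oplus> u \<otimes> a \<otimes> v) = r \<otimes> y \<oplus> (r \<otimes> u) \<otimes> a \<otimes> v"
      using y step r a by (simp add: r_distr m_assoc)
    with S_step[of "r \<otimes> y" "r \<otimes> u" v] step r show ?case by simp
  qed (use r zero in auto)
  have rmult: "x \<otimes> r \<in> S" if r: "r \<in> carrier R" and x: "x \<in> S" for r x
    using x
  proof (induction rule: S_induct)
    case (step y u v)
    have y: "y \<in> carrier R" using step S_carrier by blast
    have "(y \<oplus> u \<otimes> a \<otimes> v) \<otimes> r = y \<otimes> r \<oplus> u \<otimes> a \<otimes> (v \<otimes> r)"
      using y step r a by (simp add: l_distr m_assoc)
    with S_step[of "y \<otimes> r" u "v \<otimes> r"] step r show ?case by simp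
  qed (use r zero in auto)
  have "ideal S R"
  proof (rule idealI)
    show "subgroup S (add_monoid R)"
    proof (rule add.subgroupI)
      \<comment> \<open>Negation is left multiplication by \<open>\<ominus> \<one>\<close>.\<close>
      show "\<ominus> x \<in> S" if "x \<in> S" for x
        using lmult[of "\<ominus> \<one>" x] that S_carrier by (auto simp: l_minus)
    qed (use S_carrier zero add in auto)
  qed (use ring_axioms lmult rmult in auto)
  moreover have "a \<in> S" using S_step[OF zero, of \<one> \<one>] a by simp
  ultimately have "Idl {a} \<subseteq> S" by (simp add: genideal_minimal)
  with x show ?thesis unfolding S_def by blast
qed

lemma (in ideal) minus_mem_sym:
  assumes "x \<in> carrier R" "y \<in> carrier R" "x \<ominus> y \<in> I"
  shows "y \<ominus> x \<in> I"
proof -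
  have "\<ominus> (x \<ominus> y) \<in> I" using assms(3) by simp
  moreover have "\<ominus> (x \<ominus> y) = y \<ominus> x"
    using assms(1,2) by (simp add: a_minus_def minus_add a_comm)
  ultimately show ?thesis by simp
qed

lemma (in ideal) minus_mem_trans:
  assumes "x \<in> carrier R" "y \<in> carrier R" "z \<in> carrier R"
    and "x \<ominus> y \<in> I" "y \<ominus> z \<in> I"
  shows "x \<ominus> z \<in> I"
proof -
  have "(x \<ominus> y) \<oplus> (y \<ominus> z) \<in> I" using assms by simp
  moreover have "(x \<ominus> y) \<oplus> (y \<ominus> z) = x \<ominus> z"
    using assms(1-3) by (simp add: a_minus_def a_assoc r_neg2 r_neg1)
  ultimately show ?thesis by simp
qed

section \<open>Reduction relations and a criterion for Groebner bases\<close>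

context reduction_relation
begin

lemma red_irrefl:
  assumes "b \<in> carrier R"
  shows "\<not> red b x x"
  using terminating_no_loop[OF red_terminating[of "{b}"], of x] assms
  by (auto simp: red_by_set_def)

lemma zero_irreducible:
  assumes b: "b \<in> carrier R"
  shows "\<not> red b \<zero> y"
proof
  assume y: "red b \<zero> y"
  then have yc: "y \<in> carrier R" using red_closed b by blast
  have "y \<noteq> \<zero>" using red_irrefl b y by blast
  then have "red y y \<zero>" using red_self yc by blast
  moreover have "terminating (red_by_set red {b, y})" using red_terminating b yc by simp
  ultimately show False
    using terminating_no_2_cycle[of "red_by_set red {b, y}" \<zero> y] y
    unfolding red_by_set_def by blast
qed

lemma red_by_zero_empty: "\<not> red \<zero> x y"
proof
  assume r: "red \<zero> x y"
  then have "x \<in> carrier R" "y \<in> carrier R" using red_closed[of \<zero> x y] by auto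
  moreover have "x \<ominus> y = \<zero>" using red_ideal[OF _ r] genideal_zero by auto
  ultimately have "x = y" by simp
  with r red_irrefl show False by blast
qed

text \<open>Congruent elements are equivalent, hence by confluence have a common reduct; an
  irreducible element is its own only reduct.\<close>

lemma groebner_basis_irreducible_unique:
  assumes gb: "groebner_basis R red I B"
    and "x \<in> carrier R" "y \<in> carrier R" "x \<ominus> y \<in> I"
    and irr: "\<And>b z. b \<in> B \<Longrightarrow> \<not> red b x z" "\<And>b z. b \<in> B \<Longrightarrow> \<not> red b y z"
  shows "x = y"
proof -
  let ?r = "red_by_set red B"
  have "confluentp ?r" "equivclp ?r x y"
    using assms unfolding groebner_basis_def by blast+
  then obtain u where "?r\<^sup>*\<^sup>* x u" "?r\<^sup>*\<^sup>* y u"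
    using semiconfluentp_equivclp[of ?r]
    by (auto simp: confluentp_eq_semiconfluentp rtranclp_conversep)
  moreover have "\<not> ?r x z" "\<not> ?r y z" for z using irr unfolding red_by_set_def by blast+
  ultimately show ?thesis by (metis converse_rtranclpE)
qed

text \<open>By (A2) each step, in either direction, changes the element by a member of
  \<open>Idl {b}\<close>, which lies in \<open>I\<close>. Membership in the carrier is carried along
  because the equivalence closure lives on the whole type.\<close>

lemma equivclp_imp_congruent:
  assumes I: "ideal I R" and B: "B \<subseteq> I"
    and eq: "equivclp (red_by_set red B) x y" and x: "x \<in> carrier R"
  shows "y \<in> carrier R \<and> x \<ominus> y \<in> I"
  using eq
proof (induction rule: equivclp_induct)
  interpret I: ideal I R by fact
  case base
  then show ?case using x by (simp add: r_neg a_minus_def)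
next
  interpret I: ideal I R by fact
  case (step y z)
  then obtain b where b: "b \<in> B" "red b y z \<or> red b z y" unfolding red_by_set_def by blast
  have bc: "b \<in> carrier R" using b B I.a_subset by blast
  have sub: "Idl {b} \<subseteq> I" using genideal_minimal[OF I] b B by blast
  have z: "z \<in> carrier R" and y: "y \<in> carrier R" using b red_closed bc by blast+
  have "y \<ominus> z \<in> I"
  proof (cases "red b y z")
    case True
    then show ?thesis using red_ideal bc sub by blast
  next
    case False
    then have "z \<ominus> y \<in> I" using b red_ideal bc sub by blast
    then show ?thesis using I.minus_mem_sym y z by blast
  qed
  then show ?case using I.minus_mem_trans[OF x y z] step.IH z by blast
qed

text \<open>Termination provides normal forms, and congruent elements have congruent normal forms,
  which \<open>unique\<close> identifies. So congruent elements are joinable; this gives the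
  description of the congruence as well as confluence.\<close>

lemma groebner_basisI:
  assumes I: "ideal I R" and B: "B \<subseteq> I" "finite B"
    and unique: "\<And>x y. \<lbrakk>x \<in> carrier R; y \<in> carrier R; x \<ominus> y \<in> I;
      \<And>b z. b \<in> B \<Longrightarrow> \<not> red b x z; \<And>b z. b \<in> B \<Longrightarrow> \<not> red b y z\<rbrakk> \<Longrightarrow> x = y"
  shows "groebner_basis R red I B"
proof -
  interpret I: ideal I R by fact
  let ?r = "red_by_set red B"
  have Bc: "B \<subseteq> carrier R" using B I.a_subset by blast
  have fin: "terminating ?r" using red_terminating Bc B by blast
  have nf_eq: "\<exists>u. ?r\<^sup>*\<^sup>* x u \<and> ?r\<^sup>*\<^sup>* y u"
    if x: "x \<in> carrier R" and y: "y \<in> carrier R" and xy: "x \<ominus> y \<in> I" for x y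
  proof -
    obtain u where u: "?r\<^sup>*\<^sup>* x u" "\<And>z. \<not> ?r u z" using terminating_normal_form[OF fin] by blast
    obtain v where v: "?r\<^sup>*\<^sup>* y v" "\<And>z. \<not> ?r v z" using terminating_normal_form[OF fin] by blast
    have xu: "u \<in> carrier R" "x \<ominus> u \<in> I"
      using equivclp_imp_congruent[OF I B(1) rtranclp_into_equivclp[OF u(1)] x] by auto
    have yv: "v \<in> carrier R" "y \<ominus> v \<in> I"
      using equivclp_imp_congruent[OF I B(1) rtranclp_into_equivclp[OF v(1)] y] by auto
    have "u \<ominus> v \<in> I" using x y xu yv xy I.minus_mem_sym I.minus_mem_trans by meson
    then have "u = v"
      using unique[of u v] u(2) v(2) xu(1) yv(1) unfolding red_by_set_def by metis
    with u v show ?thesis by blast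
  qed
  have eq_iff: "equivclp ?r x y \<longleftrightarrow> x \<ominus> y \<in> I" if x: "x \<in> carrier R" and y: "y \<in> carrier R" for x y
  proof
    assume "x \<ominus> y \<in> I"
    with nf_eq x y obtain u where "?r\<^sup>*\<^sup>* x u" "?r\<^sup>*\<^sup>* y u" by blast
    then show "equivclp ?r x y"
      by (meson rtranclp_into_equivclp converse_rtranclp_into_equivclp equivclp_trans)
  qed (use equivclp_imp_congruent[OF I B(1) _ x] in blast)
  \<comment> \<open>That \<open>B\<close> generates \<open>I\<close> is a consequence: every
    \<open>x\<close> in \<open>I\<close> is equivalent to \<open>\<zero>\<close>, and equivalent
    elements are congruent modulo \<open>Idl B\<close> too.\<close>
  have "I \<subseteq> Idl B"
  proof
    fix x assume x: "x \<in> I"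
    then have xc: "x \<in> carrier R" using I.a_subset by blast
    have "x \<ominus> \<zero> = x" using xc by (simp add: a_minus_def)
    then have "equivclp ?r x \<zero>" using eq_iff x xc by simp
    then have "x \<ominus> \<zero> \<in> Idl B"
      using equivclp_imp_congruent[OF genideal_ideal[OF Bc] genideal_self[OF Bc] _ xc] by blast
    with \<open>x \<ominus> \<zero> = x\<close> show "x \<in> Idl B" by simp
  qed
  moreover have "Idl B \<subseteq> I" using genideal_minimal I B by blast
  moreover have "confluentp ?r"
  proof (rule confluentpI)
    fix x y z assume xy: "?r\<^sup>*\<^sup>* x y" and xz: "?r\<^sup>*\<^sup>* x z"
    show "\<exists>u. ?r\<^sup>*\<^sup>* y u \<and> ?r\<^sup>*\<^sup>* z u"
    proof (cases "x \<in> carrier R")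
      case True
      have "equivclp ?r y z" using xy xz
        by (meson rtranclp_into_equivclp converse_rtranclp_into_equivclp equivclp_trans)
      moreover have "y \<in> carrier R" "z \<in> carrier R"
        using equivclp_imp_congruent[OF I B(1) _ True] xy xz by (meson rtranclp_into_equivclp)+
      ultimately show ?thesis using eq_iff nf_eq by blast
    next
      case False
      \<comment> \<open>Confluence is demanded on the whole type, but an element outside the carrier
        has no reduct except itself.\<close>
      then have "\<not> ?r x w" for w using red_closed Bc unfolding red_by_set_def by blast
      then show ?thesis using xy xz by (metis converse_rtranclpE rtranclp.rtrancl_refl)
    qed
  qed
  ultimately show ?thesis unfolding groebner_basis_def using Bc eq_iff fin by blast
qed

end

section \<open>Coefficients of products with monomials\<close>

locale poly_reduction = UP_ring R P + reduction_relation R red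
  for R (structure) and P (structure) and red
begin

lemma coeff_minus [simp]:
  "\<lbrakk>p \<in> carrier P; q \<in> carrier P\<rbrakk> \<Longrightarrow> coeff P (p \<ominus>\<^bsub>P\<^esub> q) n = coeff P p n \<ominus> coeff P q n"
  by (simp add: a_minus_def)

lemma coeff_mult_monom_one:
  assumes p: "p \<in> carrier P"
  shows "coeff P (p \<otimes>\<^bsub>P\<^esub> monom P \<one> j) k = (if j \<le> k then coeff P p (k - j) else \<zero>)"
proof (cases "j \<le> k")
  case True
  have "coeff P (p \<otimes>\<^bsub>P\<^esub> monom P \<one> j) k =
      (\<Oplus>i\<in>{..k}. coeff P p i \<otimes> (if j = k - i then \<one> else \<zero>))"
    using p by simp
  also have "\<dots> = (\<Oplus>i\<in>{..k}. if k - j = i then coeff P p i else \<zero>)"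
    by (rule R.finsum_cong') (use p True in auto)
  also have "\<dots> = coeff P p (k - j)"
    by (rule R.finsum_singleton) (use p in auto)
  finally show ?thesis using True by simp
next
  case False
  have "coeff P (p \<otimes>\<^bsub>P\<^esub> monom P \<one> j) k =
      (\<Oplus>i\<in>{..k}. coeff P p i \<otimes> (if j = k - i then \<one> else \<zero>))"
    using p by simp
  also have "\<dots> = (\<Oplus>i\<in>{..k}. \<zero>)"
    by (rule R.finsum_cong') (use p False in auto)
  finally show ?thesis using False by simp
qed

lemma coeff_mult_const:
  assumes p: "p \<in> carrier P" and a: "a \<in> carrier R"
  shows "coeff P (p \<otimes>\<^bsub>P\<^esub> monom P a 0) k = coeff P p k \<otimes> a"
proof -
  have "coeff P (p \<otimes>\<^bsub>P\<^esub> monom P a 0) k =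
      (\<Oplus>i\<in>{..k}. coeff P p i \<otimes> (if 0 = k - i then a else \<zero>))"
    using p a by simp
  also have "\<dots> = (\<Oplus>i\<in>{..k}. if k = i then coeff P p i \<otimes> a else \<zero>)"
    by (rule R.finsum_cong') (use p a in auto)
  also have "\<dots> = coeff P p k \<otimes> a"
    by (rule R.finsum_singleton) (use p a in auto)
  finally show ?thesis .
qed

lemma coeff_const_mult:
  assumes "p \<in> carrier P" "a \<in> carrier R"
  shows "coeff P (monom P a 0 \<otimes>\<^bsub>P\<^esub> p) k = a \<otimes> coeff P p k"
  using assms by (simp only: monom_mult_is_smult coeff_smult)

text \<open>The sum in condition (c) without the factor \<open>X^j\<close>, so that constants act on
  it coefficientwise and the shift is treated separately.\<close>

definition multiple_sum where
  "multiple_sum f n c d =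
    (\<Oplus>\<^bsub>P\<^esub>l\<in>{1..n::nat}. monom P (c l) 0 \<otimes>\<^bsub>P\<^esub> f \<otimes>\<^bsub>P\<^esub> monom P (d l) 0)"

lemma multiple_sum_closed:
  assumes "f \<in> carrier P" "c \<in> {1..n} \<rightarrow> carrier R" "d \<in> {1..n} \<rightarrow> carrier R"
  shows "multiple_sum f n c d \<in> carrier P"
  unfolding multiple_sum_def using assms by (intro P.finsum_closed) (auto simp: Pi_def)

lemma coeff_multiple_sum:
  assumes f: "f \<in> carrier P" and c: "c \<in> {1..n} \<rightarrow> carrier R" and d: "d \<in> {1..n} \<rightarrow> carrier R"
  shows "coeff P (multiple_sum f n c d) k = (\<Oplus>l\<in>{1..n}. c l \<otimes> coeff P f k \<otimes> d l)"
proof -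
  have "coeff P (multiple_sum f n c d) k =
      (\<Oplus>l\<in>{1..n}. coeff P (monom P (c l) 0 \<otimes>\<^bsub>P\<^esub> f \<otimes>\<^bsub>P\<^esub> monom P (d l) 0) k)"
    unfolding multiple_sum_def using f c d by (intro coeff_finsum) (auto simp: Pi_def)
  also have "\<dots> = (\<Oplus>l\<in>{1..n}. c l \<otimes> coeff P f k \<otimes> d l)"
  proof (rule R.finsum_cong')
    fix l assume "l \<in> {1..n}"
    then have "c l \<in> carrier R" "d l \<in> carrier R" using c d by auto
    then show "coeff P (monom P (c l) 0 \<otimes>\<^bsub>P\<^esub> f \<otimes>\<^bsub>P\<^esub> monom P (d l) 0) k = c l \<otimes> coeff P f k \<otimes> d l"
      using f by (simp only: coeff_mult_const coeff_const_mult P.m_closed monom_closed)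
  qed (use f c d in \<open>auto simp: Pi_def\<close>)
  finally show ?thesis .
qed

lemma multiple_sum_in_ideal:
  assumes I: "ideal I P" and f: "f \<in> I"
    and c: "c \<in> {1..n} \<rightarrow> carrier R" and d: "d \<in> {1..n} \<rightarrow> carrier R"
  shows "multiple_sum f n c d \<in> I"
  using c d unfolding multiple_sum_def
proof (induction n)
  interpret I: ideal I P by fact
  case 0
  then show ?case by simp
next
  interpret I: ideal I P by fact
  case (Suc n)
  have fc: "f \<in> carrier P" using f I.a_subset by blast
  have "{1..Suc n} = insert (Suc n) {1..n}" by auto
  moreover have "monom P (c (Suc n)) 0 \<otimes>\<^bsub>P\<^esub> f \<otimes>\<^bsub>P\<^esub> monom P (d (Suc n)) 0 \<in> I"
    using Suc.prems f by (intro I.I_l_closed I.I_r_closed monom_closed) auto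
  ultimately show ?case using Suc fc by (simp add: Pi_def)
qed

section \<open>Reduction steps of polynomials and the axioms (A1) to (A3)\<close>

lemma poly_red_at_iff:
  "poly_red_at R red f i p q \<longleftrightarrow>
    f \<in> carrier P - {\<zero>\<^bsub>P\<^esub>} \<and> p \<in> carrier P - {\<zero>\<^bsub>P\<^esub>} \<and> coeff P p i \<noteq> \<zero> \<and>
    (\<exists>j b (n :: nat) c d.
       deg R f + j = i \<and>
       b \<in> carrier R \<and> c \<in> {1..n} \<rightarrow> carrier R \<and> d \<in> {1..n} \<rightarrow> carrier R \<and>
       red (head_coeff R f) (coeff P p i) b \<and>
       coeff P p i = b \<oplus> (\<Oplus>l\<in>{1..n}. c l \<otimes> head_coeff R f \<otimes> d l) \<and>
       q = p \<ominus>\<^bsub>P\<^esub> multiple_sum f n c d \<otimes>\<^bsub>P\<^esub> monom P \<one> j)"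
  unfolding poly_red_at_def multiple_sum_def P_def by (rule refl)

lemma head_coeff_closed: "f \<in> carrier P \<Longrightarrow> head_coeff R f \<in> carrier R"
  unfolding head_coeff_def P_def[symmetric] by simp

text \<open>The subtracted polynomial is a multiple of \<open>f\<close> whose coefficient at
  \<open>i\<close> is exactly the difference \<open>a - b\<close> of the reduction in
  \<open>R\<close>, and which vanishes above \<open>i\<close>. Coefficients below \<open>i\<close>
  may change arbitrarily.\<close>

lemma poly_red_atD:
  assumes "poly_red_at R red f i p q"
  shows "f \<in> carrier P" "p \<in> carrier P" "q \<in> carrier P" "coeff P p i \<noteq> \<zero>"
    "red (head_coeff R f) (coeff P p i) (coeff P q i)"
    "\<And>k. k > i \<Longrightarrow> coeff P q k = coeff P p k"
    "p \<ominus>\<^bsub>P\<^esub> q \<in> Idl\<^bsub>P\<^esub> {f}"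
proof -
  obtain j b n c d where f: "f \<in> carrier P" and p: "p \<in> carrier P" "coeff P p i \<noteq> \<zero>"
    and j: "deg R f + j = i" and b: "b \<in> carrier R"
    and c: "c \<in> {1..n} \<rightarrow> carrier R" and d: "d \<in> {1..n} \<rightarrow> carrier R"
    and rd: "red (head_coeff R f) (coeff P p i) b"
    and eq: "coeff P p i = b \<oplus> (\<Oplus>l\<in>{1..n}. c l \<otimes> head_coeff R f \<otimes> d l)"
    and q: "q = p \<ominus>\<^bsub>P\<^esub> multiple_sum f n c d \<otimes>\<^bsub>P\<^esub> monom P \<one> j"
    using assms unfolding poly_red_at_iff by blast
  let ?m = "multiple_sum f n c d"
  have m: "?m \<in> carrier P" using multiple_sum_closed f c d .
  have mj: "?m \<otimes>\<^bsub>P\<^esub> monom P \<one> j \<in> carrier P" using m by simp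
  show "f \<in> carrier P" "p \<in> carrier P" "coeff P p i \<noteq> \<zero>" by fact+
  show qc: "q \<in> carrier P" unfolding q using p mj by simp
  have qk: "coeff P q k = coeff P p k \<ominus> (if j \<le> k then coeff P ?m (k - j) else \<zero>)" for k
    unfolding q using p m mj by (simp del: coeff_mult add: coeff_mult_monom_one)
  have "coeff P ?m (i - j) = (\<Oplus>l\<in>{1..n}. c l \<otimes> head_coeff R f \<otimes> d l)" (is "_ = ?s")
    unfolding coeff_multiple_sum[OF f c d] head_coeff_def P_def[symmetric] using j by auto
  then have "coeff P q i = b \<oplus> ?s \<ominus> ?s" unfolding qk eq using j by simp
  moreover have "?s \<in> carrier R"
    using c d head_coeff_closed[OF f] by (auto intro!: R.finsum_closed simp: Pi_def)
  ultimately have "coeff P q i = b" using b by (simp add: a_minus_def R.a_assoc R.r_neg)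
  with rd show "red (head_coeff R f) (coeff P p i) (coeff P q i)" by simp
  show "coeff P q k = coeff P p k" if "k > i" for k
  proof -
    \<comment> \<open>From \<open>k > i = deg R f + j\<close> the index \<open>k - j\<close> exceeds
      the degree of \<open>f\<close>.\<close>
    have "coeff P f (k - j) = \<zero>" using deg_aboveD[OF _ f, of "k - j"] j that by simp
    then have "coeff P ?m (k - j) = (\<Oplus>l\<in>{1..n}. \<zero>)"
      unfolding coeff_multiple_sum[OF f c d] using c d by (intro R.finsum_cong') (auto simp: Pi_def)
    then show ?thesis unfolding qk using p(1) by (simp add: a_minus_def)
  qed
  interpret J: ideal "Idl\<^bsub>P\<^esub> {f}" P using f by (intro P.genideal_ideal) simp
  have "?m \<in> Idl\<^bsub>P\<^esub> {f}"
    using multiple_sum_in_ideal[OF J.is_ideal _ c d] P.genideal_self'[OF f] by blast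
  then have "?m \<otimes>\<^bsub>P\<^esub> monom P \<one> j \<in> Idl\<^bsub>P\<^esub> {f}" by (intro J.I_r_closed) auto
  moreover have "p \<ominus>\<^bsub>P\<^esub> q = ?m \<otimes>\<^bsub>P\<^esub> monom P \<one> j"
    unfolding q using p(1) mj by (simp add: a_minus_def P.minus_add P.r_neg2 P.a_assoc[symmetric] P.r_neg)
  ultimately show "p \<ominus>\<^bsub>P\<^esub> q \<in> Idl\<^bsub>P\<^esub> {f}" by simp
qed

text \<open>Every reduction of a coefficient in \<open>R\<close> extends to one of polynomials: (A2)
  puts the difference into the ideal of the head coefficient, which supplies the \<open>c\<close>
  and \<open>d\<close> of condition (b), and the shift is by \<open>i - deg R f\<close>.\<close>

lemma poly_red_at_exists:
  assumes f: "f \<in> carrier P" "f \<noteq> \<zero>\<^bsub>P\<^esub>" and p: "p \<in> carrier P" and i: "deg R f \<le> i"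
    and rd: "red (head_coeff R f) (coeff P p i) b"
  shows "\<exists>q. poly_red_at R red f i p q"
proof -
  let ?h = "head_coeff R f" and ?a = "coeff P p i"
  have h: "?h \<in> carrier R" using head_coeff_closed f by blast
  have b: "b \<in> carrier R" using red_closed[OF h rd] by blast
  have a: "?a \<in> carrier R" using p by simp
  have nz: "?a \<noteq> \<zero>" using zero_irreducible[OF h] rd by metis
  then have "p \<noteq> \<zero>\<^bsub>P\<^esub>" by auto
  obtain n c d where cd: "c \<in> {1..n::nat} \<rightarrow> carrier R" "d \<in> {1..n} \<rightarrow> carrier R"
    and eq: "?a \<ominus> b = (\<Oplus>l\<in>{1..n}. c l \<otimes> ?h \<otimes> d l)"
    using R.genideal_singleton_finsum[OF h red_ideal[OF h rd]] by blast
  have "?a = b \<oplus> (?a \<ominus> b)" using a b by (simp add: a_minus_def R.a_comm R.r_neg2)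
  with eq have "?a = b \<oplus> (\<Oplus>l\<in>{1..n}. c l \<otimes> ?h \<otimes> d l)" by simp
  moreover have "deg R f + (i - deg R f) = i" using i by simp
  ultimately show ?thesis unfolding poly_red_at_iff
    using f p \<open>p \<noteq> \<zero>\<^bsub>P\<^esub>\<close> nz b cd rd by blast
qed

text \<open>The position of reduction is eventually below every bound: once it stays at most \<open>d\<close>, the
  coefficient at \<open>d\<close> can only change by reductions in \<open>R\<close>, which happens finitely often.\<close>

lemma terminating_poly_red:
  assumes F: "F \<subseteq> carrier P" "finite F"
  shows "terminating (red_by_set (poly_red R red) F)"
  unfolding terminating_def
proof
  assume "\<exists>s. \<forall>n. red_by_set (poly_red R red) F (s n) (s (Suc n))"
  then obtain s where "\<forall>n. \<exists>f i. f \<in> F \<and> poly_red_at R red f i (s n) (s (Suc n))"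
    unfolding red_by_set_def poly_red_def by blast
  then obtain f e where f: "\<And>n. f n \<in> F" and at: "\<And>n. poly_red_at R red (f n) (e n) (s n) (s (Suc n))"
    by metis
  let ?r = "red_by_set red (head_coeff R ` F)"
  \<comment> \<open>Finiteness of \<open>F\<close> enters here: the head coefficients form a finite
    set, to which (A1) for \<open>R\<close> applies.\<close>
  have fin: "terminating ?r" using F head_coeff_closed by (intro red_terminating) auto
  have same: "coeff P (s (Suc n)) k = coeff P (s n) k" if "k > e n" for n k
    using poly_red_atD(6)[OF at that] .
  have red_step: "?r (coeff P (s n) (e n)) (coeff P (s (Suc n)) (e n))" for n
    using poly_red_atD(5)[OF at] f unfolding red_by_set_def by blast
  define D where "D = deg R (s 0)"
  \<comment> \<open>No step touches an exponent above the one it reduces, so the degree of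
    \<open>s 0\<close> bounds the whole sequence and starts the descent at
    \<open>Suc D\<close>.\<close>
  have bounded: "\<forall>k>D. coeff P (s n) k = \<zero>" for n
  proof (induction n)
    case 0
    then show ?case using deg_aboveD poly_red_atD(2)[OF at] unfolding D_def by blast
  next
    case (Suc n)
    then have "e n \<le> D" using poly_red_atD(4)[OF at] by (meson not_le)
    with Suc same show ?case by simp
  qed
  have "\<exists>M. \<forall>n\<ge>M. e n < d" if "d \<le> Suc D" for d
    using that
  proof (induction rule: inc_induct)
    case base
    have "e n < Suc D" for n
      using bounded poly_red_atD(4)[OF at] by (meson not_le less_Suc_eq_le)
    then show ?case by blast
  next
    case (step d)
    then obtain M where M: "\<And>n. n \<ge> M \<Longrightarrow> e n \<le> d" by (meson less_Suc_eq_le)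
    obtain M' where M': "M' \<ge> M" "\<And>n. n \<ge> M' \<Longrightarrow> coeff P (s n) d = coeff P (s M') d"
      using terminating_eventually_constant[OF fin, of M "\<lambda>n. coeff P (s n) d"] M same
        red_step
      by (metis le_neq_implies_less)
    have "e n \<noteq> d" if "n \<ge> M'" for n
    proof
      assume "e n = d"
      then have "?r (coeff P (s n) d) (coeff P (s (Suc n)) d)"
        using red_step by metis
      then show False
        using M'(2)[of n] M'(2)[of "Suc n"] that terminating_no_loop[OF fin] by simp
    qed
    with M M'(1) show ?case by (meson le_neq_implies_less le_trans)
  qed
  \<comment> \<open>For the bound 0 the exponents would have to be negative.\<close>
  from this[of 0] show False by auto
qed

text \<open>Reduction at the leading monomial with \<open>n = 1\<close>, both multipliers
  \<open>\<one>\<close> and \<open>j = 0\<close>, where (A3) in \<open>R\<close> sends the head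
  coefficient to \<open>\<zero>\<close>; this subtracts all of \<open>f\<close>.\<close>

lemma poly_red_self:
  assumes f: "f \<in> carrier P - {\<zero>\<^bsub>P\<^esub>}"
  shows "poly_red R red f f \<zero>\<^bsub>P\<^esub>"
proof -
  let ?h = "head_coeff R f" and ?one = "\<lambda>_::nat. \<one>"
  have h: "?h \<in> carrier R" "?h = coeff P f (deg R f)" "?h \<noteq> \<zero>"
    using f lcoeff_nonzero unfolding head_coeff_def P_def[symmetric] by auto
  have "multiple_sum f 1 ?one ?one \<otimes>\<^bsub>P\<^esub> monom P \<one> 0 = f"
    unfolding multiple_sum_def using f by simp
  then have "\<zero>\<^bsub>P\<^esub> = f \<ominus>\<^bsub>P\<^esub> multiple_sum f 1 ?one ?one \<otimes>\<^bsub>P\<^esub> monom P \<one> 0"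
    using f by (simp add: a_minus_def P.r_neg)
  moreover have "coeff P f (deg R f) = \<zero> \<oplus> (\<Oplus>l\<in>{1..1}. ?one l \<otimes> ?h \<otimes> ?one l)"
    using h by simp
  moreover have "red ?h (coeff P f (deg R f)) \<zero>" using red_self[of ?h] h by simp
  ultimately have "poly_red_at R red f (deg R f) f \<zero>\<^bsub>P\<^esub>"
    unfolding poly_red_at_iff using f h
    by (intro conjI exI[of _ 0] exI[of _ \<zero>] exI[of _ "1::nat"] exI[of _ ?one]) auto
  then show ?thesis unfolding poly_red_def by blast
qed

lemma reduction_relation_poly_red: "reduction_relation P (poly_red R red)"
proof
  show "p \<in> carrier P \<and> q \<in> carrier P" if "f \<in> carrier P" "poly_red R red f p q" for f p q
    using that poly_red_atD unfolding poly_red_def by blast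
  show "p \<ominus>\<^bsub>P\<^esub> q \<in> Idl\<^bsub>P\<^esub> {f}" if "f \<in> carrier P" "poly_red R red f p q" for f p q
    using that poly_red_atD(7) unfolding poly_red_def by blast
qed (use terminating_poly_red poly_red_self in auto)

section \<open>Ideals of leading coefficients\<close>

text \<open>The ideal \<open>L\<^sub>n\<close>. The coefficient at \<open>n\<close> may itself be
  zero, so that sums and multiples whose leading coefficients cancel remain covered.\<close>

definition lead_ideal where
  "lead_ideal I n = {coeff P f n | f. f \<in> I \<and> (\<forall>k>n. coeff P f k = \<zero>)}"

lemma lead_ideal_memI:
  "\<lbrakk>f \<in> I; \<And>k. k > n \<Longrightarrow> coeff P f k = \<zero>\<rbrakk> \<Longrightarrow> coeff P f n \<in> lead_ideal I n"
  unfolding lead_ideal_def by blast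

lemma lead_ideal_memE:
  assumes "a \<in> lead_ideal I n"
  obtains f where "f \<in> I" "a = coeff P f n" "\<And>k. k > n \<Longrightarrow> coeff P f k = \<zero>"
  using assms unfolding lead_ideal_def by blast

lemma ideal_lead_ideal:
  assumes "ideal I P"
  shows "ideal (lead_ideal I n) R"
proof -
  interpret I: ideal I P by fact
  have Ic: "f \<in> carrier P" if "f \<in> I" for f using that I.a_subset by blast
  have carrier: "lead_ideal I n \<subseteq> carrier R" by (auto elim!: lead_ideal_memE simp: Ic)
  have lmult: "r \<otimes> a \<in> lead_ideal I n" if "a \<in> lead_ideal I n" and r: "r \<in> carrier R" for r a
    using that(1)
  proof (cases rule: lead_ideal_memE)
    case (1 f)
    then have "monom P r 0 \<otimes>\<^bsub>P\<^esub> f \<in> I" using r by (intro I.I_l_closed) auto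
    from lead_ideal_memI[OF this, of n] show ?thesis
      using 1 r by (simp del: coeff_mult add: coeff_const_mult Ic)
  qed
  have rmult: "a \<otimes> r \<in> lead_ideal I n" if "a \<in> lead_ideal I n" and r: "r \<in> carrier R" for r a
    using that(1)
  proof (cases rule: lead_ideal_memE)
    case (1 f)
    then have "f \<otimes>\<^bsub>P\<^esub> monom P r 0 \<in> I" using r by (intro I.I_r_closed) auto
    from lead_ideal_memI[OF this, of n] show ?thesis
      using 1 r by (simp del: coeff_mult add: coeff_mult_const Ic)
  qed
  have zero: "\<zero> \<in> lead_ideal I n" using lead_ideal_memI[OF I.zero_closed, of n] by simp
  have add: "a \<oplus> b \<in> lead_ideal I n" if "a \<in> lead_ideal I n" "b \<in> lead_ideal I n" for a b
    using that(1)
  proof (cases rule: lead_ideal_memE)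
    case (1 f)
    from that(2) show ?thesis
    proof (cases rule: lead_ideal_memE)
      case g: (1 g)
      then show ?thesis
        using 1 lead_ideal_memI[of "f \<oplus>\<^bsub>P\<^esub> g" I n] by (simp add: Ic)
    qed
  qed
  show ?thesis
  proof (rule idealI)
    show "subgroup (lead_ideal I n) (add_monoid R)"
    proof (rule R.add.subgroupI)
      show "\<ominus> a \<in> lead_ideal I n" if "a \<in> lead_ideal I n" for a
        using lmult[of a "\<ominus> \<one>"] that carrier by (auto simp: R.l_minus)
    qed (use carrier zero add in auto)
  qed (use R.ring_axioms lmult rmult in auto)
qed

text \<open>Multiplication by \<open>X^(n - m)\<close> stays in \<open>I\<close> and moves the
  coefficient from \<open>m\<close> to \<open>n\<close>.\<close>

lemma lead_ideal_mono:
  assumes I: "ideal I P" and mn: "m \<le> n"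
  shows "lead_ideal I m \<subseteq> lead_ideal I n"
proof
  interpret I: ideal I P by fact
  fix a assume "a \<in> lead_ideal I m"
  then obtain f where f: "f \<in> I" "a = coeff P f m" "\<And>k. k > m \<Longrightarrow> coeff P f k = \<zero>"
    by (rule lead_ideal_memE) blast
  have fc: "f \<in> carrier P" using f I.a_subset by blast
  have "f \<otimes>\<^bsub>P\<^esub> monom P \<one> (n - m) \<in> I" using f by (intro I.I_r_closed) auto
  from lead_ideal_memI[OF this, of n] show "a \<in> lead_ideal I n"
    using f mn fc by (simp del: coeff_mult add: coeff_mult_monom_one)
qed

lemma lead_ideal_nonzeroE:
  assumes I: "ideal I P" and a: "a \<in> lead_ideal I n" "a \<noteq> \<zero>"
  obtains f where "f \<in> I" "f \<noteq> \<zero>\<^bsub>P\<^esub>" "deg R f = n" "head_coeff R f = a"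
proof -
  obtain f where f: "f \<in> I" "a = coeff P f n" "\<And>k. k > n \<Longrightarrow> coeff P f k = \<zero>"
    using a(1) by (rule lead_ideal_memE) blast
  have fc: "f \<in> carrier P" using f(1) additive_subgroup.a_subset[OF ideal.axioms(1)[OF I]] by blast
  have "deg R f = n"
    using deg_aboveI[of n f] deg_belowI[of n f] f fc a(2) by fastforce
  moreover have "f \<noteq> \<zero>\<^bsub>P\<^esub>" using f(2) a(2) by auto
  ultimately show thesis
    using that[of f] f unfolding head_coeff_def P_def[symmetric] by simp
qed

section \<open>Finite Groebner bases of polynomial ideals\<close>

lemma ideal_has_finite_groebner_basis:
  assumes "noetherian_reduction_ring R red" and I: "ideal I P"
  shows "\<exists>G. finite G \<and> groebner_basis P (poly_red R red) I G"
proof -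
  interpret N: noetherian_reduction_ring R red by fact
  interpret I: ideal I P by fact
  interpret Q: reduction_relation P "poly_red R red" by (rule reduction_relation_poly_red)
  have Ic: "f \<in> carrier P" if "f \<in> I" for f using that I.a_subset by blast
  \<comment> \<open>In a Noetherian ring a nonempty chain of ideals contains its union.\<close>
  have "\<Union>(range (lead_ideal I)) \<in> range (lead_ideal I)"
  proof (rule N.ideal_chain_is_trivial)
    show "subset.chain {J. ideal J R} (range (lead_ideal I))"
      unfolding subset_chain_def using ideal_lead_ideal[OF I] lead_ideal_mono[OF I]
      by (auto simp del: mem_Collect_eq) (meson nle_le subsetD)+
  qed simp
  then obtain N where "\<Union>(range (lead_ideal I)) = lead_ideal I N" by blast
  \<comment> \<open>Beyond \<open>N\<close> the ideal lies between \<open>lead_ideal I N\<close> and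
    the union, which coincide.\<close>
  then have stable: "lead_ideal I i = lead_ideal I (min i N)" for i
    using lead_ideal_mono[OF I, of N i] by (cases "i \<le> N") (auto simp: min_def)
  have "\<exists>B. finite B \<and> groebner_basis R red (lead_ideal I n) B" for n
    using N.finetely_gen[OF ideal_lead_ideal[OF I]] N.finite_groebner_basis by metis
  then obtain B where B: "\<And>n. finite (B n)" "\<And>n. groebner_basis R red (lead_ideal I n) (B n)"
    by metis
  have B_sub: "B n \<subseteq> lead_ideal I n" for n
    using B(2)[of n] R.genideal_self[of "B n"] unfolding groebner_basis_def by blast
  \<comment> \<open>Zero is excluded because it is not the head coefficient of a nonzero
    polynomial.\<close>
  have "\<exists>f. f \<in> I \<and> f \<noteq> \<zero>\<^bsub>P\<^esub> \<and> deg R f = n \<and> head_coeff R f = b"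
    if "b \<in> B n - {\<zero>}" for n b
    using lead_ideal_nonzeroE[OF I, of b n] that B_sub by blast
  then have "\<exists>l. \<forall>b \<in> B n - {\<zero>}. l b \<in> I \<and> l b \<noteq> \<zero>\<^bsub>P\<^esub> \<and> deg R (l b) = n \<and> head_coeff R (l b) = b" for n
    by (intro bchoice ballI)
  then have "\<exists>l. \<forall>n. \<forall>b \<in> B n - {\<zero>}.
      l n b \<in> I \<and> l n b \<noteq> \<zero>\<^bsub>P\<^esub> \<and> deg R (l n b) = n \<and> head_coeff R (l n b) = b"
    by (intro choice allI)
  then obtain lift where lift: "\<And>n b. b \<in> B n - {\<zero>} \<Longrightarrow>
      lift n b \<in> I \<and> lift n b \<noteq> \<zero>\<^bsub>P\<^esub> \<and> deg R (lift n b) = n \<and> head_coeff R (lift n b) = b"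
    by blast
  define G where "G = (\<Union>n\<in>{..N}. lift n ` (B n - {\<zero>}))"
  have "finite G" unfolding G_def using B(1) by auto
  have "G \<subseteq> I" unfolding G_def using lift by blast
  have "groebner_basis P (poly_red R red) I G"
  proof (rule Q.groebner_basisI[OF I \<open>G \<subseteq> I\<close> \<open>finite G\<close>])
    fix p q
    assume p: "p \<in> carrier P" and q: "q \<in> carrier P" and pq: "p \<ominus>\<^bsub>P\<^esub> q \<in> I"
      and irr: "\<And>f z. f \<in> G \<Longrightarrow> \<not> poly_red R red f p z" "\<And>f z. f \<in> G \<Longrightarrow> \<not> poly_red R red f q z"
    show "p = q"
    proof (rule ccontr)
      assume "p \<noteq> q"
      define i where "i = deg R (p \<ominus>\<^bsub>P\<^esub> q)"
      \<comment> \<open>Lifts exist in \<open>G\<close> only up to degree \<open>N\<close>; by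
        stability those of degree \<open>m\<close> serve for exponent \<open>i\<close>.\<close>
      define m where "m = min i N"
      have nz: "p \<ominus>\<^bsub>P\<^esub> q \<noteq> \<zero>\<^bsub>P\<^esub>" using \<open>p \<noteq> q\<close> p q by simp
      have diff: "p \<ominus>\<^bsub>P\<^esub> q \<in> carrier P" using p q by simp
      have "coeff P (p \<ominus>\<^bsub>P\<^esub> q) i \<noteq> \<zero>"
        unfolding i_def using nz diff by (rule lcoeff_nonzero)
      then have ne: "coeff P p i \<noteq> coeff P q i" using p q by (auto simp: a_minus_def R.r_neg)
      have "coeff P (p \<ominus>\<^bsub>P\<^esub> q) i \<in> lead_ideal I i"
        using pq diff unfolding i_def by (intro lead_ideal_memI deg_aboveD)
      then have mem: "coeff P p i \<ominus> coeff P q i \<in> lead_ideal I m"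
        using p q stable[of i] unfolding m_def by simp
      \<comment> \<open>Irreducibility passes from polynomials to their coefficients at
        \<open>i\<close>: since \<open>m \<le> i\<close>, a reduction of the coefficient by
        \<open>b\<close> would extend to one of \<open>u\<close> by \<open>lift m b\<close>.\<close>
      have irr_coeff: "\<not> red b (coeff P u i) z"
        if u: "u \<in> carrier P" and b: "b \<in> B m"
          and irr_u: "\<And>f z. f \<in> G \<Longrightarrow> \<not> poly_red R red f u z" for u b z
      proof
        assume rd: "red b (coeff P u i) z"
        then have "b \<in> B m - {\<zero>}" using b red_by_zero_empty by blast
        then have f: "lift m b \<in> I" "lift m b \<noteq> \<zero>\<^bsub>P\<^esub>" "deg R (lift m b) = m"
            "head_coeff R (lift m b) = b" "lift m b \<in> G"
          using lift[of b m] unfolding G_def m_def by auto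
        have "\<exists>w. poly_red_at R red (lift m b) i u w"
          using poly_red_at_exists[OF Ic[OF f(1)] f(2) u] f rd unfolding m_def by auto
        then show False using irr_u f(5) unfolding poly_red_def by blast
      qed
      have "coeff P p i = coeff P q i"
        using groebner_basis_irreducible_unique[OF B(2) _ _ mem] p q irr_coeff irr by simp
      with ne show False by contradiction
    qed
  qed
  with \<open>finite G\<close> show ?thesis by blast
qed

end

theorem theorem3p5p2:
  fixes R :: "('a, 'm) ring_scheme"
    and red :: "'a \<Rightarrow> 'a \<Rightarrow> 'a \<Rightarrow> bool"
  assumes "noetherian_reduction_ring R red"
  shows "noetherian_reduction_ring (UP R) (poly_red R red)"
proof -
  interpret N: noetherian_reduction_ring R red by fact
  interpret poly_reduction R "UP R" red by unfold_locales
  interpret Q: reduction_relation "UP R" "poly_red R red" by (rule reduction_relation_poly_red)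
  show ?thesis
  proof
    fix A assume "A \<subseteq> carrier (UP R)"
    then show "\<exists>B. finite B \<and> groebner_basis (UP R) (poly_red R red) (Idl\<^bsub>UP R\<^esub> A) B"
      using ideal_has_finite_groebner_basis[OF assms] P.genideal_ideal by blast
  next
    fix I assume "ideal I (UP R)"
    \<comment> \<open>A finite Groebner basis is in particular a finite generating set.\<close>
    then obtain G where "finite G" "groebner_basis (UP R) (poly_red R red) I G"
      using ideal_has_finite_groebner_basis[OF assms] by blast
    then show "\<exists>A\<subseteq>carrier (UP R). finite A \<and> I = Idl\<^bsub>UP R\<^esub> A"
      unfolding groebner_basis_def by blast
  qed
qed

end
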